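(* Let $\mathbf V$ be a variety of loops and $\mathcal W$ a set of words that generates total inner mapping groups in $\mathbf V$. Then $$[\alpha,\beta] = \mathrm{Cg}\big(\{(W_{\bar u}(a), W_{\bar v}(a)) : W\in\mathcal W,\ 1\,\alpha\,a,\ \bar u\,\beta\,\bar v\}\big)$$ for any congruences $\alpha$, $\beta$ of any $Q\in\mathbf V$.
   Context: A loop is an algebra $(Q,1,\cdot,\backslash,/)$ satisfying $x\cdot 1=x=1\cdot x$, $x\backslash(x\cdot y)=y$, $x\cdot(x\backslash y)=y$, $(y\cdot x)/x=y$, $(y/x)\cdot x=y$. For $x\in Q$ define bijections of $Q$ by $L_x(y)=xy$, $R_x(y)=yx$, $M_x(y)=y\backslash x$. The total multiplication group is $\mathrm{TMlt}(Q)=\langle L_x,R_x,M_x : x\in Q\rangle$, and the total inner mapping group $\mathrm{TInn}(Q)$ is the stabilizer of $1$ in $\mathrm{TMlt}(Q)$. A word $W=W_{\bar x}$ in a finite tuple of variables $\bar x=x_1,\dots,x_n$ is an element of the free group on the letters $K_t$, where $K\in\{L,R,M\}$ and $t$ is a loop term over $\bar x$. For a loop $Q$ and a tuple $\bar a$ over $Q$, $W_{\bar a}\in\mathrm{TMlt}(Q)$ is the mapping obtained by replacing each letter $K_{t(\bar x)}^{\pm1}$ by the actual mapping $K_{t(\bar a)}^{\pm1}$ of $Q$. The word $W$ is inner for a variety $\mathbf V$ of loops if $W_{\bar a}\in\mathrm{TInn}(Q)$ for every $Q\in\mathbf V$ and every tuple $\bar a$ over $Q$. A set $\mathcal W$ of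 inner words for $\mathbf V$ generates total inner mapping groups in $\mathbf V$ if $\mathrm{TInn}(Q)=\langle W_{\bar a} : W\in\mathcal W,\ \bar a\text{ a tuple over }Q\rangle$ for every $Q\in\mathbf V$. Commutator of congruences: for congruences $\alpha,\beta,\delta$ of an algebra $\mathbf A$, $C(\alpha,\beta;\delta)$ means that for every $(n+1)$-ary term operation $t$, every $a\,\alpha\,b$ and every $u_1\,\beta\,v_1,\dots,u_n\,\beta\,v_n$, $t(a,u_1,\dots,u_n)\,\delta\,t(a,v_1,\dots,v_n)$ implies $t(b,u_1,\dots,u_n)\,\delta\,t(b,v_1,\dots,v_n)$. The commutator $[\alpha,\beta]$ is the smallest congruence $\delta$ with $C(\alpha,\beta;\delta)$. $\mathrm{Cg}(X)$ is the congruence generated by $X$. For tuples, $\bar u\,\beta\,\bar v$ means $u_i\,\beta\,v_i$ for all $i$. *)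

theory Defs
  imports "HOL-Algebra.Bij" "HOL-Algebra.Generated_Groups"
begin

section \<open>Loops and their total multiplication groups\<close>

record 'a loop = "'a monoid" +
  ldiv :: "'a \<Rightarrow> 'a \<Rightarrow> 'a"  \<comment> \<open>\<open>ldiv Q x y\<close> is x under y, the solution z of x z = y\<close>
  rdiv :: "'a \<Rightarrow> 'a \<Rightarrow> 'a"  \<comment> \<open>\<open>rdiv Q y x\<close> is y over x, the solution z of z x = y\<close>

locale loop =
  fixes Q (structure)
  assumes one_closed [simp, intro]: "\<one> \<in> carrier Q"
    and mult_closed [simp, intro]: "\<lbrakk>x \<in> carrier Q; y \<in> carrier Q\<rbrakk> \<Longrightarrow> x \<otimes> y \<in> carrier Q"
    and ldiv_closed [simp, intro]: "\<lbrakk>x \<in> carrier Q; y \<in> carrier Q\<rbrakk> \<Longrightarrow> ldiv Q x y \<in> carrier Q"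
    and rdiv_closed [simp, intro]: "\<lbrakk>x \<in> carrier Q; y \<in> carrier Q\<rbrakk> \<Longrightarrow> rdiv Q x y \<in> carrier Q"
    and r_one [simp]: "x \<in> carrier Q \<Longrightarrow> x \<otimes> \<one> = x"
    and l_one [simp]: "x \<in> carrier Q \<Longrightarrow> \<one> \<otimes> x = x"
    and ldiv_mult [simp]: "\<lbrakk>x \<in> carrier Q; y \<in> carrier Q\<rbrakk> \<Longrightarrow> ldiv Q x (x \<otimes> y) = y"
    and mult_ldiv [simp]: "\<lbrakk>x \<in> carrier Q; y \<in> carrier Q\<rbrakk> \<Longrightarrow> x \<otimes> ldiv Q x y = y"
    and mult_rdiv [simp]: "\<lbrakk>x \<in> carrier Q; y \<in> carrier Q\<rbrakk> \<Longrightarrow> rdiv Q (y \<otimes> x) x = y"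
    and rdiv_mult [simp]: "\<lbrakk>x \<in> carrier Q; y \<in> carrier Q\<rbrakk> \<Longrightarrow> rdiv Q y x \<otimes> x = y"

text \<open>The translations are extensional functions on the carrier, so that they are elements of the
  group of all bijections of the carrier.\<close>

definition L_map :: "('a, 'm) loop_scheme \<Rightarrow> 'a \<Rightarrow> 'a \<Rightarrow> 'a"
  where "L_map Q x = (\<lambda>y\<in>carrier Q. x \<otimes>\<^bsub>Q\<^esub> y)"

definition R_map :: "('a, 'm) loop_scheme \<Rightarrow> 'a \<Rightarrow> 'a \<Rightarrow> 'a"
  where "R_map Q x = (\<lambda>y\<in>carrier Q. y \<otimes>\<^bsub>Q\<^esub> x)"

definition M_map :: "('a, 'm) loop_scheme \<Rightarrow> 'a \<Rightarrow> 'a \<Rightarrow> 'a"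
  where "M_map Q x = (\<lambda>y\<in>carrier Q. ldiv Q y x)"

definition TMlt :: "('a, 'm) loop_scheme \<Rightarrow> ('a \<Rightarrow> 'a) set"
  where "TMlt Q = generate (BijGroup (carrier Q))
    (L_map Q ` carrier Q \<union> R_map Q ` carrier Q \<union> M_map Q ` carrier Q)"

definition TInn :: "('a, 'm) loop_scheme \<Rightarrow> ('a \<Rightarrow> 'a) set"
  where "TInn Q = {f \<in> TMlt Q. f \<one>\<^bsub>Q\<^esub> = \<one>\<^bsub>Q\<^esub>}"


section \<open>Terms and varieties\<close>

datatype (term_vars: 'v) loop_term =
    TVar 'v
  | TOne
  | TMult "'v loop_term" "'v loop_term"
  | TLdiv "'v loop_term" "'v loop_term"
  | TRdiv "'v loop_term" "'v loop_term"

text \<open>A tuple is a list, and the variable \<open>TVar i\<close> denotes its entry at position \<open>i\<close>, counting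
  from 0.  A tuple \<open>us\<close> may be substituted in \<open>t\<close> if \<open>term_vars t \<subseteq> {..<length us}\<close>.\<close>

primrec eval_term :: "('a, 'm) loop_scheme \<Rightarrow> 'a list \<Rightarrow> nat loop_term \<Rightarrow> 'a"
  where
    "eval_term Q us (TVar i) = us ! i"
  | "eval_term Q us TOne = \<one>\<^bsub>Q\<^esub>"
  | "eval_term Q us (TMult s t) = eval_term Q us s \<otimes>\<^bsub>Q\<^esub> eval_term Q us t"
  | "eval_term Q us (TLdiv s t) = ldiv Q (eval_term Q us s) (eval_term Q us t)"
  | "eval_term Q us (TRdiv s t) = rdiv Q (eval_term Q us s) (eval_term Q us t)"

definition satisfies :: "('a, 'm) loop_scheme \<Rightarrow> nat loop_term \<times> nat loop_term \<Rightarrow> bool"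
  where "satisfies Q e \<longleftrightarrow>
    (\<forall>us. set us \<subseteq> carrier Q \<and> term_vars (fst e) \<union> term_vars (snd e) \<subseteq> {..<length us} \<longrightarrow>
      eval_term Q us (fst e) = eval_term Q us (snd e))"

text \<open>A variety is an equationally defined class of loops.  Since HOL cannot quantify over types
  inside a formula, classes of loops are taken relative to a universe: the members of \<open>V\<close> are the
  loops whose carrier is any subset of the type \<open>'a\<close>.  Once \<open>'a\<close> is infinite, \<open>V\<close> contains a
  copy of each of its countable members, in particular of its free loops on finitely many
  generators; over a finite \<open>'a\<close> a condition on all members of \<open>V\<close> would only concern small
  loops.\<close>

definition loop_variety :: "'a loop set \<Rightarrow> bool"
  where "loop_variety V \<longleftrightarrow> (\<exists>E. V = {Q. loop Q \<and> (\<forall>e\<in>E. satisfies Q e)})"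


section \<open>Words\<close>

datatype (letter_vars: 'v) letter =
    LLetter "'v loop_term"
  | RLetter "'v loop_term"
  | MLetter "'v loop_term"

text \<open>In \<open>(k, b)\<close> the letter \<open>k\<close> has exponent 1 if \<open>b\<close> and exponent -1 otherwise.
  Elements of the free group are represented by their normal forms, the freely reduced words.\<close>

type_synonym word = "(nat letter \<times> bool) list"

definition loop_words :: "word set"
  where "loop_words = {w. successively (\<lambda>(k, b) (l, c). \<not> (k = l \<and> b \<noteq> c)) w}"

definition word_vars :: "word \<Rightarrow> nat set"
  where "word_vars w = (\<Union>(k, b)\<in>set w. letter_vars k)"

primrec letter_map :: "('a, 'm) loop_scheme \<Rightarrow> 'a list \<Rightarrow> nat letter \<Rightarrow> 'a \<Rightarrow> 'a"
  where
    "letter_map Q us (LLetter t) = L_map Q (eval_term Q us t)"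
  | "letter_map Q us (RLetter t) = R_map Q (eval_term Q us t)"
  | "letter_map Q us (MLetter t) = M_map Q (eval_term Q us t)"

text \<open>The mapping induced by a word; the rightmost letter is applied first.\<close>

primrec word_map :: "('a, 'm) loop_scheme \<Rightarrow> 'a list \<Rightarrow> word \<Rightarrow> 'a \<Rightarrow> 'a"
  where
    "word_map Q us [] = \<one>\<^bsub>BijGroup (carrier Q)\<^esub>"
  | "word_map Q us (x # w) =
      (if snd x then letter_map Q us (fst x)
       else inv\<^bsub>BijGroup (carrier Q)\<^esub> (letter_map Q us (fst x)))
      \<otimes>\<^bsub>BijGroup (carrier Q)\<^esub> word_map Q us w"

definition inner_word :: "'a loop set \<Rightarrow> word \<Rightarrow> bool"
  where "inner_word V w \<longleftrightarrow>
    (\<forall>Q\<in>V. \<forall>us. set us \<subseteq> carrier Q \<and> word_vars w \<subseteq> {..<length us} \<longrightarrow> word_map Q us w \<in> TInn Q)"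

definition generates_TInn :: "'a loop set \<Rightarrow> word set \<Rightarrow> bool"
  where "generates_TInn V \<W> \<longleftrightarrow>
    (\<forall>w\<in>\<W>. inner_word V w) \<and>
    (\<forall>Q\<in>V. TInn Q = generate (BijGroup (carrier Q))
      {word_map Q us w | w us. w \<in> \<W> \<and> set us \<subseteq> carrier Q \<and> word_vars w \<subseteq> {..<length us}})"


section \<open>Congruences and their commutator\<close>

definition loop_congruence :: "('a, 'm) loop_scheme \<Rightarrow> ('a \<times> 'a) set \<Rightarrow> bool"
  where "loop_congruence Q \<theta> \<longleftrightarrow> equiv (carrier Q) \<theta> \<and>
    (\<forall>x x' y y'. (x, x') \<in> \<theta> \<and> (y, y') \<in> \<theta> \<longrightarrow>
      (x \<otimes>\<^bsub>Q\<^esub> y, x' \<otimes>\<^bsub>Q\<^esub> y') \<in> \<theta> \<and>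
      (ldiv Q x y, ldiv Q x' y') \<in> \<theta> \<and>
      (rdiv Q x y, rdiv Q x' y') \<in> \<theta>)"

definition Cg :: "('a, 'm) loop_scheme \<Rightarrow> ('a \<times> 'a) set \<Rightarrow> ('a \<times> 'a) set"
  where "Cg Q X = \<Inter>{\<theta>. loop_congruence Q \<theta> \<and> X \<subseteq> \<theta>}"

definition centralizes ::
    "('a, 'm) loop_scheme \<Rightarrow> ('a \<times> 'a) set \<Rightarrow> ('a \<times> 'a) set \<Rightarrow> ('a \<times> 'a) set \<Rightarrow> bool"
  where "centralizes Q \<alpha> \<beta> \<delta> \<longleftrightarrow>
    (\<forall>t a b us vs. (a, b) \<in> \<alpha> \<and> list_all2 (\<lambda>u v. (u, v) \<in> \<beta>) us vs \<and>
        term_vars t \<subseteq> {..<Suc (length us)} \<and>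
        (eval_term Q (a # us) t, eval_term Q (a # vs) t) \<in> \<delta> \<longrightarrow>
      (eval_term Q (b # us) t, eval_term Q (b # vs) t) \<in> \<delta>)"

text \<open>The least congruence \<open>\<delta>\<close> with \<open>centralizes Q \<alpha> \<beta> \<delta>\<close>; the lemmas below show that the
  intersection is itself such a congruence.\<close>

definition commutator ::
    "('a, 'm) loop_scheme \<Rightarrow> ('a \<times> 'a) set \<Rightarrow> ('a \<times> 'a) set \<Rightarrow> ('a \<times> 'a) set"
  where "commutator Q \<alpha> \<beta> = \<Inter>{\<delta>. loop_congruence Q \<delta> \<and> centralizes Q \<alpha> \<beta> \<delta>}"


section \<open>Basic facts\<close>

context loop
begin

lemma ldiv_rdiv [simp]:
  assumes "x \<in> carrier Q" "y \<in> carrier Q"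
  shows "ldiv Q (rdiv Q x y) x = y" "rdiv Q x (ldiv Q y x) = y"
  using assms ldiv_mult [of "rdiv Q x y" y] mult_rdiv [of "ldiv Q y x" y] by simp_all

lemma L_map_Bij: "x \<in> carrier Q \<Longrightarrow> L_map Q x \<in> Bij (carrier Q)"
  unfolding Bij_def L_map_def
  by (auto intro!: bij_betw_byWitness [where f' = "ldiv Q x"])

lemma R_map_Bij: "x \<in> carrier Q \<Longrightarrow> R_map Q x \<in> Bij (carrier Q)"
  unfolding Bij_def R_map_def
  by (auto intro!: bij_betw_byWitness [where f' = "\<lambda>y. rdiv Q y x"])

lemma M_map_Bij: "x \<in> carrier Q \<Longrightarrow> M_map Q x \<in> Bij (carrier Q)"
  unfolding Bij_def M_map_def
  by (auto intro!: bij_betw_byWitness [where f' = "rdiv Q x"])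

lemma eval_term_closed:
  "\<lbrakk>set us \<subseteq> carrier Q; term_vars t \<subseteq> {..<length us}\<rbrakk> \<Longrightarrow> eval_term Q us t \<in> carrier Q"
  by (induction t) auto

lemma loop_congruence_full: "loop_congruence Q (carrier Q \<times> carrier Q)"
  by (auto simp: loop_congruence_def equiv_def refl_on_def sym_def trans_def)

lemma loop_congruence_Inter:
  assumes "S \<noteq> {}" "\<And>\<theta>. \<theta> \<in> S \<Longrightarrow> loop_congruence Q \<theta>"
  shows "loop_congruence Q (\<Inter>S)"
proof -
  have "\<And>\<theta>. \<theta> \<in> S \<Longrightarrow> \<theta> \<subseteq> carrier Q \<times> carrier Q \<and> refl_on (carrier Q) \<theta> \<and> sym \<theta> \<and> trans \<theta>"
    using assms(2) by (simp add: loop_congruence_def equiv_def)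
  then have "equiv (carrier Q) (\<Inter>S)"
    using \<open>S \<noteq> {}\<close> unfolding equiv_def
    by (intro conjI sym_INTER [of S id, simplified] trans_INTER [of S id, simplified])
      (auto simp: refl_on_def)
  then show ?thesis
    using assms(2) unfolding loop_congruence_def by (simp; blast)
qed

lemma Cg_congruence:
  assumes "X \<subseteq> carrier Q \<times> carrier Q"
  shows "loop_congruence Q (Cg Q X)"
  unfolding Cg_def using assms loop_congruence_full
  by (intro loop_congruence_Inter) auto

lemma Cg_superset: "X \<subseteq> Cg Q X"
  by (auto simp: Cg_def)

lemma Cg_least: "\<lbrakk>loop_congruence Q \<theta>; X \<subseteq> \<theta>\<rbrakk> \<Longrightarrow> Cg Q X \<subseteq> \<theta>"
  by (auto simp: Cg_def)

lemma centralizes_full: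
  assumes "loop_congruence Q \<alpha>" "loop_congruence Q \<beta>"
  shows "centralizes Q \<alpha> \<beta> (carrier Q \<times> carrier Q)"
proof -
  have sub: "\<alpha> \<subseteq> carrier Q \<times> carrier Q" "\<beta> \<subseteq> carrier Q \<times> carrier Q"
    using assms by (auto simp: loop_congruence_def equiv_def)
  have "(eval_term Q (b # us) t, eval_term Q (b # vs) t) \<in> carrier Q \<times> carrier Q"
    if "(a, b) \<in> \<alpha>" and l: "list_all2 (\<lambda>u v. (u, v) \<in> \<beta>) us vs"
      and t: "term_vars t \<subseteq> {..<Suc (length us)}" for t a b us vs
  proof -
    have "set us \<subseteq> carrier Q \<and> set vs \<subseteq> carrier Q"
      using l by induction (use sub in auto)
    moreover have "b \<in> carrier Q" "length us = length vs"
      using that sub by (auto dest: list_all2_lengthD)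
    ultimately show ?thesis
      using t by (auto intro!: eval_term_closed)
  qed
  then show ?thesis
    unfolding centralizes_def by blast
qed

lemma commutator_congruence:
  assumes "loop_congruence Q \<alpha>" "loop_congruence Q \<beta>"
  shows "loop_congruence Q (commutator Q \<alpha> \<beta>)"
  unfolding commutator_def using centralizes_full [OF assms] loop_congruence_full
  by (intro loop_congruence_Inter) auto

lemma commutator_centralizes: "centralizes Q \<alpha> \<beta> (commutator Q \<alpha> \<beta>)"
  unfolding commutator_def centralizes_def by blast

lemma commutator_least:
  "\<lbrakk>loop_congruence Q \<delta>; centralizes Q \<alpha> \<beta> \<delta>\<rbrakk> \<Longrightarrow> commutator Q \<alpha> \<beta> \<subseteq> \<delta>"
  by (auto simp: commutator_def)

end

end

(* Mappings induced by words are term functions, so C(alpha, beta; [alpha, beta]) carries the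
   equation W_u(1) = 1 = W_v(1) over to (W_u(a), W_v(a)) in [alpha, beta].

   Conversely, let delta be the congruence on the right hand side.  If W is any word with
   W_u(1) = 1 for all u in Q, then in a relatively free loop W is a product of words in the
   generating set, whence (W_u(a), W_v(a)) is in delta whenever 1 alpha a and u beta v.  By induction
   on t, the quotient t(a,u) \ t(b,u) is obtained from elements alpha-related to 1 by such inner
   mappings with parameters depending on u, so it is delta-related to t(a,v) \ t(b,v), and
   C(alpha, beta; delta) follows. *)

theory Submission
  imports Defs "HOL-Library.Countable"
begin

section \<open>Words as terms\<close>

lemma eval_term_Cons_shift [simp]:
  "eval_term Q (a # us) (map_loop_term Suc t) = eval_term Q us t"
  by (induction t) auto

text \<open>The term \<open>s\<close> is the argument of the letter. In the last clause,
  \<open>ldiv y t = z\<close> means \<open>t = y z\<close>, that is \<open>y = rdiv t z\<close>, so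
  an inverted M is again a division of \<open>t\<close>.\<close>

primrec letter_term :: "'v letter \<Rightarrow> bool \<Rightarrow> 'v loop_term \<Rightarrow> 'v loop_term"
  where
    "letter_term (LLetter t) b s = (if b then TMult t s else TLdiv t s)"
  | "letter_term (RLetter t) b s = (if b then TMult s t else TRdiv s t)"
  | "letter_term (MLetter t) b s = (if b then TLdiv s t else TRdiv t s)"

text \<open>Variable 0 is the argument of the mapping; the variables of the word are shifted by 1.\<close>

primrec word_term :: "word \<Rightarrow> nat loop_term"
  where
    "word_term [] = TVar 0"
  | "word_term (x # w) = letter_term (map_letter Suc (fst x)) (snd x) (word_term w)"

definition word_inverse :: "word \<Rightarrow> word"
  where "word_inverse w = rev (map (\<lambda>(k, b). (k, \<not> b)) w)"

lemma term_vars_letter_term [simp]: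
  "term_vars (letter_term k b s) = letter_vars k \<union> term_vars s"
  by (cases k) auto

lemma word_vars_simps [simp]:
  "word_vars [] = {}"
  "word_vars (x # w) = letter_vars (fst x) \<union> word_vars w"
  "word_vars (w @ w') = word_vars w \<union> word_vars w'"
  by (auto simp: word_vars_def)

lemma word_vars_inverse [simp]: "word_vars (word_inverse w) = word_vars w"
  by (force simp: word_vars_def word_inverse_def)

lemma term_vars_word_term: "term_vars (word_term w) \<subseteq> insert 0 (Suc ` word_vars w)"
  by (induction w) (auto simp: letter.set_map)

section \<open>Permutations induced by words\<close>

lemma BijGroup_mult:
  "\<lbrakk>g \<in> Bij S; f \<in> Bij S\<rbrakk> \<Longrightarrow> g \<otimes>\<^bsub>BijGroup S\<^esub> f = compose S g f"
  by (simp add: BijGroup_def)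

lemma carrier_BijGroup [simp]: "carrier (BijGroup S) = Bij S"
  by (simp add: BijGroup_def)

lemma one_BijGroup: "\<one>\<^bsub>BijGroup S\<^esub> = (\<lambda>x\<in>S. x)"
  by (simp add: BijGroup_def)

text \<open>A right inverse on \<open>S\<close> is the inverse because \<open>f\<close> is injective
  there. The claim is pointwise, since the group inverse is extensional while \<open>g\<close> may
  be arbitrary outside \<open>S\<close>.\<close>

lemma inv_BijGroup_eqI:
  assumes "f \<in> Bij S" "g \<in> S \<rightarrow> S" "\<And>y. y \<in> S \<Longrightarrow> f (g y) = y" "y \<in> S"
  shows "(inv\<^bsub>BijGroup S\<^esub> f) y = g y"
proof -
  have "(inv\<^bsub>BijGroup S\<^esub> f) y = inv_into S f y"
    using assms by (simp add: inv_BijGroup)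
  also have "\<dots> = g y"
    using assms by (intro inv_into_f_eq) (auto simp: Bij_def bij_betw_def)
  finally show ?thesis .
qed

context loop
begin

interpretation B: group "BijGroup (carrier Q)"
  by (rule group_BijGroup)

lemma ldiv_self [simp]: "x \<in> carrier Q \<Longrightarrow> ldiv Q x x = \<one>"
  using ldiv_mult [of x \<one>] by simp

lemma letter_map_Bij:
  "\<lbrakk>set us \<subseteq> carrier Q; letter_vars k \<subseteq> {..<length us}\<rbrakk> \<Longrightarrow> letter_map Q us k \<in> Bij (carrier Q)"
  by (cases k) (auto intro: L_map_Bij R_map_Bij M_map_Bij eval_term_closed)

lemma word_map_Bij:
  "\<lbrakk>set us \<subseteq> carrier Q; word_vars w \<subseteq> {..<length us}\<rbrakk> \<Longrightarrow> word_map Q us w \<in> Bij (carrier Q)"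
proof (induction w)
  case Nil
  show ?case using B.one_closed by simp
next
  case (Cons x w)
  then have "letter_map Q us (fst x) \<in> Bij (carrier Q)" "word_map Q us w \<in> Bij (carrier Q)"
    by (auto intro: letter_map_Bij)
  then show ?case
    using B.m_closed B.inv_closed by auto
qed

lemma word_map_closed:
  "\<lbrakk>set us \<subseteq> carrier Q; word_vars w \<subseteq> {..<length us}; y \<in> carrier Q\<rbrakk>
    \<Longrightarrow> word_map Q us w y \<in> carrier Q"
  using word_map_Bij Bij_imp_funcset by blast

text \<open>Writing the argument as the value of a term \<open>s\<close> at \<open>y # us\<close>
  makes this the inductive step of \<open>word_map_eval\<close>. The shift keeps the variables of
  the letter off position 0, which holds \<open>y\<close>.\<close>

lemma letter_map_eval:
  assumes us: "set us \<subseteq> carrier Q" and k: "letter_vars k \<subseteq> {..<length us}"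
    and s: "eval_term Q (y # us) s \<in> carrier Q"
  shows "(if b then letter_map Q us k else inv\<^bsub>BijGroup (carrier Q)\<^esub> (letter_map Q us k))
      (eval_term Q (y # us) s) = eval_term Q (y # us) (letter_term (map_letter Suc k) b s)"
proof (cases k)
  case (LLetter t)
  then have t: "eval_term Q us t \<in> carrier Q"
    using us k by (auto intro: eval_term_closed)
  have "(inv\<^bsub>BijGroup (carrier Q)\<^esub> (L_map Q (eval_term Q us t))) z = ldiv Q (eval_term Q us t) z"
    if "z \<in> carrier Q" for z
    using t that by (intro inv_BijGroup_eqI L_map_Bij) (auto simp: L_map_def)
  then show ?thesis
    using s LLetter by (simp add: L_map_def)
next
  case (RLetter t)
  then have t: "eval_term Q us t \<in> carrier Q"
    using us k by (auto intro: eval_term_closed)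
  have "(inv\<^bsub>BijGroup (carrier Q)\<^esub> (R_map Q (eval_term Q us t))) z = rdiv Q z (eval_term Q us t)"
    if "z \<in> carrier Q" for z
    using t that
    by (intro inv_BijGroup_eqI [where g = "\<lambda>z. rdiv Q z (eval_term Q us t)"] R_map_Bij)
      (auto simp: R_map_def)
  then show ?thesis
    using s RLetter by (simp add: R_map_def)
next
  case (MLetter t)
  then have t: "eval_term Q us t \<in> carrier Q"
    using us k by (auto intro: eval_term_closed)
  have "(inv\<^bsub>BijGroup (carrier Q)\<^esub> (M_map Q (eval_term Q us t))) z = rdiv Q (eval_term Q us t) z"
    if "z \<in> carrier Q" for z
    using t that by (intro inv_BijGroup_eqI M_map_Bij) (auto simp: M_map_def)
  then show ?thesis
    using s MLetter by (simp add: M_map_def)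
qed

text \<open>This reduces words to terms: compatibility with congruences, preservation by
  homomorphisms and the term condition all reach \<open>word_map\<close> through it.\<close>

lemma word_map_eval:
  assumes "set us \<subseteq> carrier Q" "word_vars w \<subseteq> {..<length us}" "y \<in> carrier Q"
  shows "word_map Q us w y = eval_term Q (y # us) (word_term w)"
  using assms
proof (induction w)
  case Nil
  then show ?case by (simp add: one_BijGroup)
next
  case (Cons x w)
  let ?g = "if snd x then letter_map Q us (fst x)
    else inv\<^bsub>BijGroup (carrier Q)\<^esub> (letter_map Q us (fst x))"
  have k: "letter_vars (fst x) \<subseteq> {..<length us}" and w: "word_vars w \<subseteq> {..<length us}"
    using Cons.prems by auto
  have g: "?g \<in> Bij (carrier Q)"
    using letter_map_Bij [OF Cons.prems(1) k] B.inv_closed by auto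
  have eq: "word_map Q us w y = eval_term Q (y # us) (word_term w)"
    using Cons w by simp
  then have "eval_term Q (y # us) (word_term w) \<in> carrier Q"
    using word_map_closed [OF Cons.prems(1) w Cons.prems(3)] by simp
  then have "?g (word_map Q us w y) = eval_term Q (y # us) (word_term (x # w))"
    using letter_map_eval [OF Cons.prems(1) k, where b = "snd x"] eq by simp
  moreover have "word_map Q us (x # w) = compose (carrier Q) ?g (word_map Q us w)"
    using BijGroup_mult [OF g word_map_Bij [OF Cons.prems(1) w]] by simp
  ultimately show ?case
    using Cons.prems(3) by (simp add: compose_eq)
qed

lemma word_map_append:
  assumes us: "set us \<subseteq> carrier Q"
    and w: "word_vars w \<subseteq> {..<length us}" "word_vars w' \<subseteq> {..<length us}"
  shows "word_map Q us (w @ w') =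
    word_map Q us w \<otimes>\<^bsub>BijGroup (carrier Q)\<^esub> word_map Q us w'"
  using w
proof (induction w)
  case Nil
  then show ?case using word_map_Bij [OF us] by simp
next
  case (Cons x w)
  then show ?case
    using us letter_map_Bij [of us "fst x"] word_map_Bij [of us w] word_map_Bij [of us w']
      B.inv_closed [of "letter_map Q us (fst x)"]
    by (simp add: B.m_assoc)
qed

lemma word_map_inverse:
  assumes us: "set us \<subseteq> carrier Q" and w: "word_vars w \<subseteq> {..<length us}"
  shows "word_map Q us (word_inverse w) = inv\<^bsub>BijGroup (carrier Q)\<^esub> (word_map Q us w)"
  using w
proof (induction w)
  case Nil
  then show ?case by (simp add: word_inverse_def)
next
  case (Cons x w)
  obtain k b where x: "x = (k, b)" by (cases x)
  have k: "letter_map Q us k \<in> Bij (carrier Q)" and w: "word_map Q us w \<in> Bij (carrier Q)"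
    using Cons.prems x letter_map_Bij [OF us] word_map_Bij [OF us] by auto
  have "word_inverse (x # w) = word_inverse w @ [(k, \<not> b)]"
    by (simp add: word_inverse_def x)
  then have "word_map Q us (word_inverse (x # w)) = inv\<^bsub>BijGroup (carrier Q)\<^esub> (word_map Q us w)
      \<otimes>\<^bsub>BijGroup (carrier Q)\<^esub> word_map Q us [(k, \<not> b)]"
    using Cons x by (simp add: word_map_append us del: word_map.simps)
  then show ?case
    using k w B.inv_closed [of "letter_map Q us k"] by (cases b) (simp_all add: x B.inv_mult_group)
qed

lemma word_map_inverse_cancel:
  assumes us: "set us \<subseteq> carrier Q" and w: "word_vars w \<subseteq> {..<length us}" and y: "y \<in> carrier Q"
  shows "word_map Q us (word_inverse w) (word_map Q us w y) = y"
    and "word_map Q us w (word_map Q us (word_inverse w) y) = y"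
proof -
  have W: "word_map Q us w \<in> Bij (carrier Q)" "word_map Q us (word_inverse w) \<in> Bij (carrier Q)"
    using word_map_Bij [OF us] w by auto
  have "compose (carrier Q) (word_map Q us (word_inverse w)) (word_map Q us w) =
      (\<lambda>x\<in>carrier Q. x)"
    "compose (carrier Q) (word_map Q us w) (word_map Q us (word_inverse w)) = (\<lambda>x\<in>carrier Q. x)"
    using W B.l_inv B.r_inv
    by (simp_all add: BijGroup_mult [symmetric] word_map_inverse us w flip: one_BijGroup)
  then show "word_map Q us (word_inverse w) (word_map Q us w y) = y"
    "word_map Q us w (word_map Q us (word_inverse w) y) = y"
    using y by (metis compose_eq restrict_apply')+
qed

lemma word_map_TMlt:
  assumes us: "set us \<subseteq> carrier Q" and w: "word_vars w \<subseteq> {..<length us}"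
  shows "word_map Q us w \<in> TMlt Q"
  using w
proof (induction w)
  case Nil
  show ?case by (simp add: TMlt_def generate.one)
next
  case (Cons x w)
  let ?K = "L_map Q ` carrier Q \<union> R_map Q ` carrier Q \<union> M_map Q ` carrier Q"
  have "letter_map Q us (fst x) \<in> ?K"
    using us Cons.prems by (cases "fst x") (auto intro!: imageI eval_term_closed)
  then have "(if snd x then letter_map Q us (fst x)
      else inv\<^bsub>BijGroup (carrier Q)\<^esub> (letter_map Q us (fst x)))
      \<in> generate (BijGroup (carrier Q)) ?K"
    by (simp add: generate.incl generate.inv)
  with Cons show ?case
    by (simp add: TMlt_def generate.eng)
qed


section \<open>Congruences\<close>

lemma congruence_closed:
  "\<lbrakk>loop_congruence Q \<theta>; (x, y) \<in> \<theta>\<rbrakk> \<Longrightarrow> x \<in> carrier Q \<and> y \<in> carrier Q"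
  by (auto simp: loop_congruence_def equiv_def)

lemma congruence_refl: "\<lbrakk>loop_congruence Q \<theta>; x \<in> carrier Q\<rbrakk> \<Longrightarrow> (x, x) \<in> \<theta>"
  by (auto simp: loop_congruence_def equiv_def refl_on_def)

lemma congruence_sym: "\<lbrakk>loop_congruence Q \<theta>; (x, y) \<in> \<theta>\<rbrakk> \<Longrightarrow> (y, x) \<in> \<theta>"
  by (auto simp: loop_congruence_def equiv_def dest: symD)

lemma congruence_trans:
  "\<lbrakk>loop_congruence Q \<theta>; (x, y) \<in> \<theta>; (y, z) \<in> \<theta>\<rbrakk> \<Longrightarrow> (x, z) \<in> \<theta>"
  unfolding loop_congruence_def equiv_def by (blast dest: transD)

lemma congruence_ops:
  assumes "loop_congruence Q \<theta>" "(x, x') \<in> \<theta>" "(y, y') \<in> \<theta>"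
  shows "(x \<otimes> y, x' \<otimes> y') \<in> \<theta>" "(ldiv Q x y, ldiv Q x' y') \<in> \<theta>" "(rdiv Q x y, rdiv Q x' y') \<in> \<theta>"
  using assms unfolding loop_congruence_def by blast+

lemma congruence_list_closed:
  assumes "loop_congruence Q \<theta>" "list_all2 (\<lambda>u v. (u, v) \<in> \<theta>) us vs"
  shows "set us \<subseteq> carrier Q" "set vs \<subseteq> carrier Q" "length us = length vs"
proof -
  from assms(2) have "set us \<subseteq> carrier Q \<and> set vs \<subseteq> carrier Q"
    by induction (use congruence_closed [OF assms(1)] in auto)
  then show "set us \<subseteq> carrier Q" "set vs \<subseteq> carrier Q" by auto
  show "length us = length vs" using assms(2) by (rule list_all2_lengthD)
qed

lemma congruence_list_refl:
  assumes "loop_congruence Q \<theta>" "set us \<subseteq> carrier Q"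
  shows "list_all2 (\<lambda>u v. (u, v) \<in> \<theta>) us us"
  using assms congruence_refl by (auto simp: list_all2_same)

lemma congruence_eval:
  assumes "loop_congruence Q \<theta>" "list_all2 (\<lambda>u v. (u, v) \<in> \<theta>) us vs" "term_vars t \<subseteq> {..<length us}"
  shows "(eval_term Q us t, eval_term Q vs t) \<in> \<theta>"
  using assms(3) assms(2)
  by (induction t)
    (auto intro: congruence_ops [OF assms(1)] congruence_refl [OF assms(1)] list_all2_nthD)

lemma congruence_word_map:
  assumes \<theta>: "loop_congruence Q \<theta>" and us: "list_all2 (\<lambda>u v. (u, v) \<in> \<theta>) us vs"
    and w: "word_vars w \<subseteq> {..<length us}" and xy: "(x, y) \<in> \<theta>"
  shows "(word_map Q us w x, word_map Q vs w y) \<in> \<theta>"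
proof -
  note c = congruence_list_closed [OF \<theta> us]
  have "word_map Q us w x = eval_term Q (x # us) (word_term w)"
    "word_map Q vs w y = eval_term Q (y # vs) (word_term w)"
    using c w congruence_closed [OF \<theta> xy] by (auto intro!: word_map_eval)
  moreover have "term_vars (word_term w) \<subseteq> {..<length (x # us)}"
    using term_vars_word_term [of w] w by fastforce
  ultimately show ?thesis
    using congruence_eval [OF \<theta>, of "x # us" "y # vs"] us xy by simp
qed

end


section \<open>Homomorphisms and relatively free loops\<close>

definition loop_hom :: "('a, 'm) loop_scheme \<Rightarrow> ('b, 'n) loop_scheme \<Rightarrow> ('a \<Rightarrow> 'b) \<Rightarrow> bool"
  where "loop_hom F Q h \<longleftrightarrow> h ` carrier F \<subseteq> carrier Q \<and> h \<one>\<^bsub>F\<^esub> = \<one>\<^bsub>Q\<^esub> \<and>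
    (\<forall>x\<in>carrier F. \<forall>y\<in>carrier F. h (x \<otimes>\<^bsub>F\<^esub> y) = h x \<otimes>\<^bsub>Q\<^esub> h y \<and>
      h (ldiv F x y) = ldiv Q (h x) (h y) \<and> h (rdiv F x y) = rdiv Q (h x) (h y))"

lemma loop_hom_closed: "\<lbrakk>loop_hom F Q h; x \<in> carrier F\<rbrakk> \<Longrightarrow> h x \<in> carrier Q"
  by (auto simp: loop_hom_def)

lemma loop_hom_eval:
  assumes F: "loop F" and h: "loop_hom F Q h" and us: "set us \<subseteq> carrier F"
    and t: "term_vars t \<subseteq> {..<length us}"
  shows "h (eval_term F us t) = eval_term Q (map h us) t"
  using t by (induction t) (use h us in \<open>auto simp: loop_hom_def loop.eval_term_closed [OF F]\<close>)

lemma loop_hom_word_map: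
  assumes F: "loop F" and Q: "loop Q" and h: "loop_hom F Q h" and us: "set us \<subseteq> carrier F"
    and w: "word_vars w \<subseteq> {..<length us}" and y: "y \<in> carrier F"
  shows "h (word_map F us w y) = word_map Q (map h us) w (h y)"
proof -
  have "term_vars (word_term w) \<subseteq> {..<length (y # us)}"
    using term_vars_word_term [of w] w by fastforce
  then have "h (word_map F us w y) = eval_term Q (map h (y # us)) (word_term w)"
    using loop.word_map_eval [OF F us w y] loop_hom_eval [OF F h, of "y # us"] us y by simp
  also have "\<dots> = word_map Q (map h us) w (h y)"
    using us w y loop_hom_closed [OF h] by (subst loop.word_map_eval [OF Q]) auto
  finally show ?thesis .
qed

instance loop_term :: (countable) countable
  by countable_datatype

text \<open>The loop of \<open>m\<close>-ary term functions of \<open>Q\<close>.  It has only countably many elements, so it can be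
  carried by a subset of any infinite type, and \<open>ev us\<close> is evaluation at the tuple \<open>us\<close>.\<close>

lemma relatively_free_loop_exists:
  fixes Q :: "('b, 'm) loop_scheme"
  assumes "infinite (UNIV :: 'a set)" and Q: "loop Q"
  obtains F :: "'a loop" and ev :: "'b list \<Rightarrow> 'a \<Rightarrow> 'b" and xs :: "'a list"
  where "loop F" "set xs \<subseteq> carrier F" "length xs = m"
    "\<And>us. \<lbrakk>set us \<subseteq> carrier Q; length us = m\<rbrakk> \<Longrightarrow> loop_hom F Q (ev us)"
    "\<And>us. \<lbrakk>set us \<subseteq> carrier Q; length us = m\<rbrakk> \<Longrightarrow> map (ev us) xs = us"
    "\<And>x. x \<in> carrier F \<Longrightarrow> \<exists>t. term_vars t \<subseteq> {..<m} \<and> x = eval_term F xs t"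
    "\<And>x y. \<lbrakk>x \<in> carrier F; y \<in> carrier F;
      \<And>us. \<lbrakk>set us \<subseteq> carrier Q; length us = m\<rbrakk> \<Longrightarrow> ev us x = ev us y\<rbrakk> \<Longrightarrow> x = y"
proof -
  obtain e :: "nat \<Rightarrow> 'a" where e: "inj e"
    using infinite_countable_subset [OF assms(1)] by blast
  define U where "U = {us. set us \<subseteq> carrier Q \<and> length us = m}"
  define T where "T = {t :: nat loop_term. term_vars t \<subseteq> {..<m}}"
  define sim where "sim s t \<longleftrightarrow> s \<in> T \<and> t \<in> T \<and> (\<forall>us\<in>U. eval_term Q us s = eval_term Q us t)" for s t
  \<comment> \<open>The term picked by \<open>SOME\<close> depends only on the
    \<open>sim\<close>-class of \<open>t\<close>. Terms over \<open>nat\<close> are countable, so it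
    has a numerical code, which \<open>e\<close> places in \<open>'a\<close>.\<close>
  define \<Phi> where "\<Phi> t = e (to_nat (SOME s. sim s t))" for t
  \<comment> \<open>\<open>\<Psi> x\<close> is some term with code \<open>x\<close>, perhaps not the
    one picked by \<open>SOME\<close>, but \<open>sim\<close>-equal to it. Hence its value at a
    tuple is determined by \<open>x\<close>.\<close>
  define \<Psi> where "\<Psi> = inv_into T \<Phi>"
  define ev where "ev us x = eval_term Q us (\<Psi> x)" for us x
  define F :: "'a loop" where "F = \<lparr>carrier = \<Phi> ` T,
    mult = \<lambda>x y. \<Phi> (TMult (\<Psi> x) (\<Psi> y)), one = \<Phi> TOne,
    ldiv = \<lambda>x y. \<Phi> (TLdiv (\<Psi> x) (\<Psi> y)), rdiv = \<lambda>x y. \<Phi> (TRdiv (\<Psi> x) (\<Psi> y))\<rparr>"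
  define xs where "xs = map (\<lambda>i. \<Phi> (TVar i)) [0..<m]"
  have T: "TOne \<in> T" "\<And>i. i < m \<Longrightarrow> TVar i \<in> T"
    "\<And>s t. s \<in> T \<Longrightarrow> t \<in> T \<Longrightarrow> TMult s t \<in> T \<and> TLdiv s t \<in> T \<and> TRdiv s t \<in> T"
    by (auto simp: T_def)
  have some: "sim (SOME s. sim s t) t" if "t \<in> T" for t
    by (rule someI [of "\<lambda>s. sim s t" t]) (simp add: sim_def that)
  have \<Phi>_eq: "\<Phi> s = \<Phi> t \<longleftrightarrow> sim s t" if st: "s \<in> T" "t \<in> T" for s t
  proof
    assume "\<Phi> s = \<Phi> t"
    then have "to_nat (SOME r. sim r s) = to_nat (SOME r. sim r t)"
      unfolding \<Phi>_def by (rule injD [OF e])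
    then have "(SOME r. sim r s) = (SOME r. sim r t)"
      by (rule injD [OF inj_to_nat])
    then obtain r where "sim r s" "sim r t"
      using some [OF st(1)] some [OF st(2)] by auto
    then show "sim s t"
      using st by (simp add: sim_def)
  next
    assume "sim s t"
    then have "(\<lambda>r. sim r s) = (\<lambda>r. sim r t)"
      by (intro ext) (simp add: sim_def st)
    then show "\<Phi> s = \<Phi> t" by (simp add: \<Phi>_def)
  qed
  have \<Psi>: "\<Psi> x \<in> T" "\<Phi> (\<Psi> x) = x" if "x \<in> \<Phi> ` T" for x
    using that unfolding \<Psi>_def by (rule inv_into_into, rule f_inv_into_f)
  have ev_\<Phi>: "ev us (\<Phi> t) = eval_term Q us t" if "t \<in> T" "us \<in> U" for us t
  proof -
    have "sim (\<Psi> (\<Phi> t)) t"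
      using \<Phi>_eq [of "\<Psi> (\<Phi> t)" t] \<Psi> [of "\<Phi> t"] that(1) by simp
    then show ?thesis
      using that(2) by (simp add: sim_def ev_def)
  qed
  \<comment> \<open>The evaluations jointly separate points, so \<open>F\<close> embeds in a power
    of \<open>Q\<close>. The loop axioms for \<open>F\<close> are derived by applying
    \<open>ev us\<close> to both sides.\<close>
  have sep: "x = y" if "x \<in> carrier F" "y \<in> carrier F" "\<And>us. us \<in> U \<Longrightarrow> ev us x = ev us y" for x y
  proof -
    have xy: "x \<in> \<Phi> ` T" "y \<in> \<Phi> ` T"
      using that by (simp_all add: F_def)
    then have "sim (\<Psi> x) (\<Psi> y)"
      using that(3) \<Psi>(1) by (simp add: sim_def ev_def)
    then show ?thesis
      using \<Phi>_eq [of "\<Psi> x" "\<Psi> y"] \<Psi> xy by simp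
  qed
  have closed: "\<one>\<^bsub>F\<^esub> \<in> carrier F" "\<And>x y. x \<in> carrier F \<Longrightarrow> y \<in> carrier F \<Longrightarrow>
      x \<otimes>\<^bsub>F\<^esub> y \<in> carrier F \<and> ldiv F x y \<in> carrier F \<and> rdiv F x y \<in> carrier F"
    using T \<Psi> by (auto simp: F_def)
  have ev_closed: "ev us x \<in> carrier Q" if "x \<in> carrier F" "us \<in> U" for us x
    using that \<Psi> [of x] loop.eval_term_closed [OF Q, of us "\<Psi> x"]
    by (simp add: F_def ev_def T_def U_def)
  have ev_ops: "ev us \<one>\<^bsub>F\<^esub> = \<one>\<^bsub>Q\<^esub>" "\<And>x y. x \<in> carrier F \<Longrightarrow> y \<in> carrier F \<Longrightarrow>
      ev us (x \<otimes>\<^bsub>F\<^esub> y) = ev us x \<otimes>\<^bsub>Q\<^esub> ev us y \<and>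
      ev us (ldiv F x y) = ldiv Q (ev us x) (ev us y) \<and>
      ev us (rdiv F x y) = rdiv Q (ev us x) (ev us y)" if "us \<in> U" for us
  proof -
    show "ev us \<one>\<^bsub>F\<^esub> = \<one>\<^bsub>Q\<^esub>"
      using ev_\<Phi> [OF T(1) that] by (simp add: F_def)
    show "ev us (x \<otimes>\<^bsub>F\<^esub> y) = ev us x \<otimes>\<^bsub>Q\<^esub> ev us y \<and>
        ev us (ldiv F x y) = ldiv Q (ev us x) (ev us y) \<and>
        ev us (rdiv F x y) = rdiv Q (ev us x) (ev us y)"
      if "x \<in> carrier F" "y \<in> carrier F" for x y
    proof -
      have "\<Psi> x \<in> T" "\<Psi> y \<in> T"
        using \<Psi>(1) that by (simp_all add: F_def)
      then have "TMult (\<Psi> x) (\<Psi> y) \<in> T" "TLdiv (\<Psi> x) (\<Psi> y) \<in> T" "TRdiv (\<Psi> x) (\<Psi> y) \<in> T"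
        using T(3) by auto
      from this [THEN ev_\<Phi>, OF \<open>us \<in> U\<close>] show ?thesis
        unfolding F_def by (simp add: ev_def)
    qed
  qed
  have F: "loop F"
    by unfold_locales
      (use closed in \<open>auto simp: ev_ops ev_closed loop.r_one [OF Q] loop.l_one [OF Q]
        loop.ldiv_mult [OF Q] loop.mult_ldiv [OF Q] loop.mult_rdiv [OF Q] loop.rdiv_mult [OF Q]
        intro: sep [of "mult F _ _"] sep [of "ldiv F _ _"] sep [of "rdiv F _ _"]\<close>)
  have hom: "loop_hom F Q (ev us)" if "set us \<subseteq> carrier Q" "length us = m" for us
    using that ev_ops [of us] ev_closed by (auto simp: loop_hom_def U_def)
  have ev_xs: "map (ev us) xs = us" if "set us \<subseteq> carrier Q" "length us = m" for us
    using that T by (auto simp: xs_def ev_\<Phi> U_def intro: nth_equalityI)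
  have xs: "set xs \<subseteq> carrier F" "length xs = m"
    using T by (auto simp: xs_def F_def)
  have gen: "\<exists>t. term_vars t \<subseteq> {..<m} \<and> x = eval_term F xs t" if "x \<in> carrier F" for x
  proof -
    obtain t where t: "t \<in> T" "x = \<Phi> t" using \<open>x \<in> carrier F\<close> by (auto simp: F_def)
    have "x = eval_term F xs t"
    proof (rule sep)
      show "eval_term F xs t \<in> carrier F"
        using loop.eval_term_closed [OF F] xs t by (simp add: T_def)
      show "ev us x = ev us (eval_term F xs t)" if "us \<in> U" for us
        using loop_hom_eval [OF F hom xs(1)] ev_xs ev_\<Phi> [OF t(1) that] that t xs
        by (simp add: T_def U_def)
    qed (fact that)
    with t show ?thesis by (auto simp: T_def)
  qed
  show ?thesis
    using sep by (intro that [OF F xs hom ev_xs gen]) (simp_all add: U_def)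
qed


section \<open>Inner words and the commutator\<close>

context loop
begin

text \<open>Group generation also uses inverses, hence this lemma. For \<open>b = W_v^-1(a)\<close>
  one has \<open>W_v(b) = a\<close>, and \<open>b\<close> is \<alpha>-related to
  \<open>\<one>\<close> because \<open>W_v^-1\<close> fixes \<open>\<one>\<close>. So
  \<open>rel\<close> at \<open>b\<close> gives \<open>W_u(b)\<close> \<delta> \<open>a\<close>, and
  applying \<open>W_u^-1\<close> to both sides finishes.\<close>

lemma word_inverse_related:
  assumes \<alpha>: "loop_congruence Q \<alpha>" and \<delta>: "loop_congruence Q \<delta>"
    and us: "set us \<subseteq> carrier Q" and vs: "set vs \<subseteq> carrier Q"
    and w: "word_vars w \<subseteq> {..<length us}" "word_vars w \<subseteq> {..<length vs}"
    and one: "word_map Q vs w \<one> = \<one>"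
    and rel: "\<And>a. (\<one>, a) \<in> \<alpha> \<Longrightarrow> (word_map Q us w a, word_map Q vs w a) \<in> \<delta>"
    and a: "(\<one>, a) \<in> \<alpha>"
  shows "(word_map Q us (word_inverse w) a, word_map Q vs (word_inverse w) a) \<in> \<delta>"
proof -
  have ac: "a \<in> carrier Q" using congruence_closed [OF \<alpha> a] by simp
  define b where "b = word_map Q vs (word_inverse w) a"
  have bc: "b \<in> carrier Q" and wb: "word_map Q vs w b = a"
    using vs w ac by (auto simp: b_def word_map_closed word_map_inverse_cancel)
  have "word_map Q vs (word_inverse w) \<one> = \<one>"
    using word_map_inverse_cancel(1) [OF vs w(2) one_closed] one by simp
  then have "(\<one>, b) \<in> \<alpha>"
    using congruence_word_map [OF \<alpha> congruence_list_refl [OF \<alpha> vs], of "word_inverse w" \<one> a] w a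
    by (simp add: b_def)
  from rel [OF this] have "(word_map Q us w b, a) \<in> \<delta>"
    by (simp add: wb)
  from congruence_word_map [OF \<delta> congruence_list_refl [OF \<delta> us] _ this, of "word_inverse w"]
  have "(b, word_map Q us (word_inverse w) a) \<in> \<delta>"
    using us w bc by (simp add: word_map_inverse_cancel)
  then show ?thesis
    unfolding b_def [symmetric] by (rule congruence_sym [OF \<delta>])
qed

end

lemma inner_word_fixes_one:
  assumes "inner_word V w" "Q \<in> V" "set us \<subseteq> carrier Q" "word_vars w \<subseteq> {..<length us}"
  shows "word_map Q us w \<one>\<^bsub>Q\<^esub> = \<one>\<^bsub>Q\<^esub>"
proof -
  have "word_map Q us w \<in> TInn Q"
    using assms unfolding inner_word_def by blast
  then show ?thesis by (simp add: TInn_def)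
qed

text \<open>In the relatively free loop \<open>F\<close> on variables for \<open>us\<close> and one further variable \<open>y\<close>, the mapping
  given by \<open>w\<close> is a product of mappings given by words in \<open>\<W>\<close>.  The equality of their values at \<open>y\<close>
  is an identity of \<open>Q\<close>, and it may be evaluated at \<open>(us, a)\<close> and at \<open>(vs, a)\<close>; it is harmless that
  the parameters of the factors may involve \<open>y\<close>.\<close>

lemma inner_word_related:
  fixes V :: "'a loop set"
  assumes universe: "infinite (UNIV :: 'a set)" and V: "loop_variety V"
    and generates: "generates_TInn V \<W>" and Q: "Q \<in> V"
    and \<alpha>: "loop_congruence Q \<alpha>" and \<beta>: "loop_congruence Q \<beta>" and \<delta>: "loop_congruence Q \<delta>"
    and rel: "\<And>w a us vs. \<lbrakk>w \<in> \<W>; (\<one>\<^bsub>Q\<^esub>, a) \<in> \<alpha>; list_all2 (\<lambda>u v. (u, v) \<in> \<beta>) us vs;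
        word_vars w \<subseteq> {..<length us}\<rbrakk> \<Longrightarrow> (word_map Q us w a, word_map Q vs w a) \<in> \<delta>"
    and fixes_one: "\<And>zs. \<lbrakk>set zs \<subseteq> carrier Q; length zs = length us\<rbrakk> \<Longrightarrow> word_map Q zs w \<one>\<^bsub>Q\<^esub> = \<one>\<^bsub>Q\<^esub>"
    and w: "word_vars w \<subseteq> {..<length us}"
    and uv: "list_all2 (\<lambda>u v. (u, v) \<in> \<beta>) us vs"
    and a: "(\<one>\<^bsub>Q\<^esub>, a) \<in> \<alpha>"
  shows "(word_map Q us w a, word_map Q vs w a) \<in> \<delta>"
proof -
  obtain E where E: "V = {Q. loop Q \<and> (\<forall>e\<in>E. satisfies Q e)}"
    using V by (auto simp: loop_variety_def)
  interpret Q: loop Q using E Q by simp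
  let ?n = "length us"
  obtain F :: "'a loop" and ev xs
    where F: "loop F" and xs: "set xs \<subseteq> carrier F" and len: "length xs = Suc ?n"
      and hom: "\<And>us'. \<lbrakk>set us' \<subseteq> carrier Q; length us' = Suc ?n\<rbrakk> \<Longrightarrow> loop_hom F Q (ev us')"
      and ev_xs: "\<And>us'. \<lbrakk>set us' \<subseteq> carrier Q; length us' = Suc ?n\<rbrakk> \<Longrightarrow> map (ev us') xs = us'"
      and gen_xs: "\<And>x. x \<in> carrier F \<Longrightarrow> \<exists>t. term_vars t \<subseteq> {..<Suc ?n} \<and> x = eval_term F xs t"
      and sep: "\<And>x y. \<lbrakk>x \<in> carrier F; y \<in> carrier F;
        \<And>us'. \<lbrakk>set us' \<subseteq> carrier Q; length us' = Suc ?n\<rbrakk> \<Longrightarrow> ev us' x = ev us' y\<rbrakk> \<Longrightarrow> x = y"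
    by (rule relatively_free_loop_exists [OF universe Q.loop_axioms, where m = "Suc ?n"]) blast
  interpret F: loop F by (rule F)
  \<comment> \<open>An identity of \<open>Q\<close> holds after every evaluation, hence in
    \<open>F\<close>. So \<open>F\<close> belongs to \<open>V\<close>, and \<open>generates\<close>
    describes \<open>TInn F\<close>.\<close>
  have "satisfies F e" if "e \<in> E" for e
    unfolding satisfies_def
  proof (intro allI impI)
    fix ts
    assume ts: "set ts \<subseteq> carrier F \<and>
      term_vars (fst e) \<union> term_vars (snd e) \<subseteq> {..<length ts}"
    show "eval_term F ts (fst e) = eval_term F ts (snd e)"
    proof (rule sep)
      fix us' assume us': "set us' \<subseteq> carrier Q" "length us' = Suc ?n"
      have "set (map (ev us') ts) \<subseteq> carrier Q"
        using ts loop_hom_closed [OF hom [OF us']] by auto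
      moreover have "satisfies Q e"
        using Q E that by simp
      ultimately show "ev us' (eval_term F ts (fst e)) = ev us' (eval_term F ts (snd e))"
        using ts by (simp add: loop_hom_eval [OF F hom [OF us']] satisfies_def)
    qed (use ts F.eval_term_closed in auto)
  qed
  then have FV: "F \<in> V" using E F by simp

  define ys where "ys = butlast xs"
  define y where "y = last xs"
  have xs_eq: "xs = ys @ [y]" and lys: "length ys = ?n"
    using len by (auto simp: ys_def y_def append_butlast_last_id simp flip: length_greater_0_conv)
  have ys: "set ys \<subseteq> carrier F" and y: "y \<in> carrier F"
    using xs xs_eq by auto
  note uvc = Q.congruence_list_closed [OF \<beta> uv]
  have ac: "a \<in> carrier Q" using Q.congruence_closed [OF \<alpha> a] by simp
  \<comment> \<open>Two evaluations of \<open>F\<close> in \<open>Q\<close>: they send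
    \<open>ys\<close> to \<open>us\<close> and \<open>vs\<close> respectively, and both send the
    extra variable \<open>y\<close> to \<open>a\<close>.\<close>
  define u where "u = ev (us @ [a])"
  define v where "v = ev (vs @ [a])"
  have hu: "loop_hom F Q u" and hv: "loop_hom F Q v"
    using hom uvc ac by (auto simp: u_def v_def)
  have uy: "map u ys = us" "u y = a" and vy: "map v ys = vs" "v y = a"
    using ev_xs [of "us @ [a]"] ev_xs [of "vs @ [a]"] uvc ac lys
    by (auto simp: u_def v_def xs_eq)

  \<comment> \<open>Each evaluation turns \<open>ys\<close> into a tuple of \<open>Q\<close> of the
    same length, where \<open>fixes_one\<close> applies.\<close>
  have "word_map F ys w \<one>\<^bsub>F\<^esub> = \<one>\<^bsub>F\<^esub>"
  proof (rule sep)
    fix us' assume us': "set us' \<subseteq> carrier Q" "length us' = Suc ?n"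
    have "set (map (ev us') ys) \<subseteq> carrier Q"
      using ys loop_hom_closed [OF hom [OF us']] by auto
    then show "ev us' (word_map F ys w \<one>\<^bsub>F\<^esub>) = ev us' \<one>\<^bsub>F\<^esub>"
      using fixes_one [of "map (ev us') ys"] loop_hom_word_map [OF F Q.loop_axioms hom [OF us'] ys] w lys
        hom [OF us']
      by (simp add: loop_hom_def)
  qed (use F.word_map_closed [OF ys] w lys in auto)
  then have inn: "word_map F ys w \<in> TInn F"
    using F.word_map_TMlt [OF ys] w lys by (simp add: TInn_def)

  \<comment> \<open>\<open>R\<close> contains \<open>y\<close> and will be invariant under
    \<open>TInn F\<close>. Membership of \<open>W_ys(y)\<close> in \<open>R\<close> then contains
    the claim in its \<delta> component; the \<alpha> components keep the values in the class of
    \<open>\<one>\<close>, where \<open>rel\<close> applies.\<close>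
  define R where "R = {f \<in> carrier F.
    (\<one>\<^bsub>Q\<^esub>, u f) \<in> \<alpha> \<and> (\<one>\<^bsub>Q\<^esub>, v f) \<in> \<alpha> \<and> (u f, v f) \<in> \<delta>}"
  \<comment> \<open>Applied to parameters of the factors. They are terms in \<open>xs\<close>, and
    the values of \<open>xs\<close> under \<open>u\<close> and \<open>v\<close> are \<beta>-related
    entry by entry, the last pair being \<open>(a, a)\<close>.\<close>
  have uv_eval: "(u f, v f) \<in> \<beta>" if "f \<in> carrier F" for f
  proof -
    obtain t where t: "term_vars t \<subseteq> {..<Suc ?n}" "f = eval_term F xs t"
      using gen_xs [OF \<open>f \<in> carrier F\<close>] by blast
    have "list_all2 (\<lambda>u v. (u, v) \<in> \<beta>) (us @ [a]) (vs @ [a])"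
      using uv Q.congruence_refl [OF \<beta> ac] by (simp add: list_all2_appendI)
    then have "(eval_term Q (us @ [a]) t, eval_term Q (vs @ [a]) t) \<in> \<beta>"
      using t by (intro Q.congruence_eval [OF \<beta>]) auto
    moreover have "u f = eval_term Q (us @ [a]) t" "v f = eval_term Q (vs @ [a]) t"
      using loop_hom_eval [OF F hu xs, of t] loop_hom_eval [OF F hv xs, of t] t len uy vy
      by (simp_all add: xs_eq)
    ultimately show ?thesis by simp
  qed
  \<comment> \<open>The change from \<open>u\<close> to \<open>v\<close> is split: first the
    argument moves from \<open>u f\<close> to \<open>v f\<close> inside \<delta> with the parameters
    fixed, then the parameters change at \<open>v f\<close>, which is \<alpha>-related to
    \<open>\<one>\<close>.\<close>
  have word: "word_map F ts z f \<in> R"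
    if z: "\<And>zs. \<lbrakk>set zs \<subseteq> carrier Q; word_vars z \<subseteq> {..<length zs}\<rbrakk> \<Longrightarrow>
        word_map Q zs z \<one>\<^bsub>Q\<^esub> = \<one>\<^bsub>Q\<^esub>"
      and r: "\<And>a. (\<one>\<^bsub>Q\<^esub>, a) \<in> \<alpha> \<Longrightarrow> (word_map Q (map u ts) z a, word_map Q (map v ts) z a) \<in> \<delta>"
      and ts: "set ts \<subseteq> carrier F" "word_vars z \<subseteq> {..<length ts}" and f: "f \<in> R" for z ts f
  proof -
    have fc: "f \<in> carrier F" and f': "(\<one>\<^bsub>Q\<^esub>, u f) \<in> \<alpha>" "(\<one>\<^bsub>Q\<^esub>, v f) \<in> \<alpha>" "(u f, v f) \<in> \<delta>"
      using f by (auto simp: R_def)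
    have c: "set (map u ts) \<subseteq> carrier Q" "set (map v ts) \<subseteq> carrier Q"
      using ts loop_hom_closed [OF hu] loop_hom_closed [OF hv] by auto
    have eq: "u (word_map F ts z f) = word_map Q (map u ts) z (u f)"
      "v (word_map F ts z f) = word_map Q (map v ts) z (v f)"
      using loop_hom_word_map [OF F Q.loop_axioms hu ts fc]
        loop_hom_word_map [OF F Q.loop_axioms hv ts fc] by auto
    have "(word_map Q zs z \<one>\<^bsub>Q\<^esub>, word_map Q zs z b) \<in> \<alpha>"
      if "set zs \<subseteq> carrier Q" "length zs = length ts" "(\<one>\<^bsub>Q\<^esub>, b) \<in> \<alpha>" for zs b
      using that ts Q.congruence_word_map [OF \<alpha> Q.congruence_list_refl [OF \<alpha>]] by auto
    then have "(\<one>\<^bsub>Q\<^esub>, u (word_map F ts z f)) \<in> \<alpha>" "(\<one>\<^bsub>Q\<^esub>, v (word_map F ts z f)) \<in> \<alpha>"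
      unfolding eq using c f' ts z by (metis length_map)+
    moreover have "(u (word_map F ts z f), v (word_map F ts z f)) \<in> \<delta>"
    proof (rule Q.congruence_trans [OF \<delta>])
      show "(u (word_map F ts z f), word_map Q (map u ts) z (v f)) \<in> \<delta>"
        unfolding eq using Q.congruence_word_map [OF \<delta> Q.congruence_list_refl [OF \<delta> c(1)]] ts f'
        by simp
      show "(word_map Q (map u ts) z (v f), v (word_map F ts z f)) \<in> \<delta>"
        unfolding eq using r f' by simp
    qed
    moreover have "word_map F ts z f \<in> carrier F"
      using F.word_map_closed ts fc by simp
    ultimately show ?thesis by (simp add: R_def)
  qed
  have gen: "word_map F ts z f \<in> R \<and> word_map F ts (word_inverse z) f \<in> R"
    if z: "z \<in> \<W>" and ts: "set ts \<subseteq> carrier F" "word_vars z \<subseteq> {..<length ts}" and f: "f \<in> R"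
    for z ts f
  proof -
    have z1: "word_map Q zs z \<one>\<^bsub>Q\<^esub> = \<one>\<^bsub>Q\<^esub>"
      if "set zs \<subseteq> carrier Q" "word_vars z \<subseteq> {..<length zs}" for zs
      using inner_word_fixes_one [OF _ Q that] generates z by (simp add: generates_TInn_def)
    have z2: "word_map Q zs (word_inverse z) \<one>\<^bsub>Q\<^esub> = \<one>\<^bsub>Q\<^esub>"
      if "set zs \<subseteq> carrier Q" "word_vars z \<subseteq> {..<length zs}" for zs
      using Q.word_map_inverse_cancel(1) [OF that Q.one_closed] z1 [OF that] by simp
    have c: "set (map u ts) \<subseteq> carrier Q" "set (map v ts) \<subseteq> carrier Q"
      using ts loop_hom_closed [OF hu] loop_hom_closed [OF hv] by auto
    have "list_all2 (\<lambda>u v. (u, v) \<in> \<beta>) (map u ts) (map v ts)"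
      using ts(1) uv_eval by (auto simp: list_all2_conv_all_nth subset_iff)
    then have r: "(word_map Q (map u ts) z b, word_map Q (map v ts) z b) \<in> \<delta>"
      if "(\<one>\<^bsub>Q\<^esub>, b) \<in> \<alpha>" for b
      using rel z that ts by simp
    have "(word_map Q (map u ts) (word_inverse z) b, word_map Q (map v ts) (word_inverse z) b) \<in> \<delta>"
      if "(\<one>\<^bsub>Q\<^esub>, b) \<in> \<alpha>" for b
      using Q.word_inverse_related [OF \<alpha> \<delta> c _ _ _ r that] z1 [OF c(2)] ts by simp
    then show ?thesis
      using word [OF z1 r ts f] word [of "word_inverse z" ts f] z2 ts f by simp
  qed
  \<comment> \<open>Bijectivity is carried through the induction because the product of
    \<open>BijGroup\<close> is known to be composition only on members of
    \<open>Bij\<close>.\<close>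
  have "g \<in> Bij (carrier F) \<and> (\<forall>f\<in>R. g f \<in> R)" if "g \<in> TInn F" for g
  proof -
    have "g \<in> generate (BijGroup (carrier F))
      {word_map F us w | w us. w \<in> \<W> \<and> set us \<subseteq> carrier F \<and> word_vars w \<subseteq> {..<length us}}"
      using that generates FV by (simp add: generates_TInn_def)
    then show ?thesis
    proof induction
      case one
      show ?case
        unfolding one_BijGroup by (rule conjI [OF id_Bij]) (simp add: R_def)
    next
      case (incl h)
      then show ?case using gen F.word_map_Bij by auto
    next
      case (inv h)
      then obtain ts z where h: "h = word_map F ts z" "z \<in> \<W>" "set ts \<subseteq> carrier F"
        "word_vars z \<subseteq> {..<length ts}" by auto
      then have "inv\<^bsub>BijGroup (carrier F)\<^esub> h = word_map F ts (word_inverse z)"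
        by (simp add: F.word_map_inverse)
      with h show ?case using gen F.word_map_Bij by auto
    next
      case (eng h1 h2)
      then show ?case
        by (auto simp: BijGroup_mult compose_Bij compose_eq R_def)
    qed
  qed
  moreover have "y \<in> R"
    using y a uy vy ac Q.congruence_refl [OF \<delta>] by (simp add: R_def)
  ultimately have "word_map F ys w y \<in> R"
    using inn by blast
  then show ?thesis
    using loop_hom_word_map [OF F Q.loop_axioms hu ys _ y] loop_hom_word_map [OF F Q.loop_axioms hv ys _ y]
      w lys uy vy by (simp add: R_def)
qed

section \<open>From inner mappings to the term condition\<close>

text \<open>The assumption \<open>inner\<close> is free of \<open>V\<close> and \<open>\<W>\<close>:
  it concerns every word fixing \<open>\<one>\<close> at all tuples of the given length in
  \<open>Q\<close>. It can thus be fed with words written down explicitly.\<close>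

locale inner_related = loop +
  fixes \<alpha> \<beta> \<delta>
  assumes \<alpha>: "loop_congruence Q \<alpha>" and \<beta>: "loop_congruence Q \<beta>" and \<delta>: "loop_congruence Q \<delta>"
    and inner: "\<And>w us vs y. \<lbrakk>word_vars w \<subseteq> {..<length us};
        \<And>zs. \<lbrakk>set zs \<subseteq> carrier Q; length zs = length us\<rbrakk> \<Longrightarrow> word_map Q zs w \<one> = \<one>;
        list_all2 (\<lambda>u v. (u, v) \<in> \<beta>) us vs; (\<one>, y) \<in> \<alpha>\<rbrakk>
      \<Longrightarrow> (word_map Q us w y, word_map Q vs w y) \<in> \<delta>"
begin

text \<open>This relation is stable under composition and under all translations, because the
  factors are then transformed by the inner mappings \<open>L\<^sub>c\<^sup>-\<^sup>1 L\<^sub>p\<^sup>-\<^sup>1 L\<^bsub>pc\<^esub>\<close> and \<open>L\<^bsub>f p\<^esub>\<^sup>-\<^sup>1 f L\<^sub>p\<close>.\<close>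

definition same_factor :: "'a \<Rightarrow> 'a \<Rightarrow> 'a \<Rightarrow> 'a \<Rightarrow> bool"
  where "same_factor p q p' q' \<longleftrightarrow> (p, q) \<in> \<alpha> \<and> (p', q') \<in> \<alpha> \<and> (p, p') \<in> \<beta> \<and> (q, q') \<in> \<beta> \<and>
    (ldiv Q p q, ldiv Q p' q') \<in> \<delta>"

lemma same_factor_refl:
  assumes "(p, p') \<in> \<beta>"
  shows "same_factor p p p' p'"
proof -
  have p: "p \<in> carrier Q" "p' \<in> carrier Q"
    using congruence_closed [OF \<beta> assms] by auto
  then have "(ldiv Q p p, ldiv Q p' p') \<in> \<delta>"
    using congruence_refl [OF \<delta> one_closed] by simp
  then show ?thesis
    unfolding same_factor_def using assms p by (intro conjI congruence_refl [OF \<alpha>])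
qed

text \<open>Parameters are changed first, at \<open>y\<close>, which is known to be \<alpha>-related
  to \<open>\<one>\<close>; the argument then moves to \<open>z\<close> by compatibility of
  \<delta>.\<close>

lemma inner_cong:
  assumes w: "word_vars w \<subseteq> {..<length us}"
    and fixes_one: "\<And>zs. \<lbrakk>set zs \<subseteq> carrier Q; length zs = length us\<rbrakk> \<Longrightarrow> word_map Q zs w \<one> = \<one>"
    and us: "list_all2 (\<lambda>u v. (u, v) \<in> \<beta>) us vs" and y: "(\<one>, y) \<in> \<alpha>" and yz: "(y, z) \<in> \<delta>"
  shows "(word_map Q us w y, word_map Q vs w z) \<in> \<delta>"
proof (rule congruence_trans [OF \<delta>])
  show "(word_map Q us w y, word_map Q vs w y) \<in> \<delta>"
    by (rule inner [OF w fixes_one us y])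
  show "(word_map Q vs w y, word_map Q vs w z) \<in> \<delta>"
    using congruence_list_closed [OF \<beta> us] w yz
    by (intro congruence_word_map [OF \<delta>] congruence_list_refl [OF \<delta>]) auto
qed

lemma ldiv_one_related:
  assumes "(p, q) \<in> \<alpha>"
  shows "(\<one>, ldiv Q p q) \<in> \<alpha>"
proof -
  have p: "p \<in> carrier Q"
    using congruence_closed [OF \<alpha> assms] by simp
  show ?thesis
    using congruence_ops(2) [OF \<alpha> congruence_refl [OF \<alpha> p] assms] p by simp
qed

text \<open>With \<open>c = ldiv Q p q\<close> one has \<open>p c = q\<close>, so
  \<open>L_c^-1 L_p^-1 L_(pc)\<close> sends \<open>ldiv Q q r\<close> to
  \<open>ldiv Q c (ldiv Q p r)\<close>. Multiplying by \<open>c\<close> on the left gives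
  \<open>ldiv Q p r\<close> as a product of \<open>c\<close> and an inner image of the second
  factor.\<close>

lemma same_factor_trans:
  assumes "same_factor p q p' q'" "same_factor q r q' r'"
  shows "same_factor p r p' r'"
proof -
  have \<alpha>s: "(p, q) \<in> \<alpha>" "(p', q') \<in> \<alpha>" "(q, r) \<in> \<alpha>" "(q', r') \<in> \<alpha>"
    and \<beta>s: "(p, p') \<in> \<beta>" "(q, q') \<in> \<beta>" "(r, r') \<in> \<beta>"
    and \<delta>s: "(ldiv Q p q, ldiv Q p' q') \<in> \<delta>" "(ldiv Q q r, ldiv Q q' r') \<in> \<delta>"
    using assms by (auto simp: same_factor_def)
  have cl: "p \<in> carrier Q" "q \<in> carrier Q" "r \<in> carrier Q"
      "p' \<in> carrier Q" "q' \<in> carrier Q" "r' \<in> carrier Q"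
    using \<beta>s [THEN congruence_closed [OF \<beta>]] by auto
  \<comment> \<open>Variable 0 stands for \<open>p\<close> and variable 1 for
    \<open>c = ldiv Q p q\<close>.\<close>
  define w :: word where "w = [(LLetter (TVar 1), False), (LLetter (TVar 0), False),
    (LLetter (TMult (TVar 0) (TVar 1)), True)]"
  have w: "word_vars w \<subseteq> {..<Suc (Suc 0)}" by (simp add: w_def)
  have map: "word_map Q [x, c] w y = ldiv Q c (ldiv Q x ((x \<otimes> c) \<otimes> y))"
    if "x \<in> carrier Q" "c \<in> carrier Q" "y \<in> carrier Q" for x c y
    using word_map_eval [of "[x, c]" w y] that w by (simp add: w_def)
  have eq: "ldiv Q x z = ldiv Q x y \<otimes> word_map Q [x, ldiv Q x y] w (ldiv Q y z)"
    if "x \<in> carrier Q" "y \<in> carrier Q" "z \<in> carrier Q" for x y z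
    using that by (simp add: map)
  have "(word_map Q [p, ldiv Q p q] w (ldiv Q q r), word_map Q [p', ldiv Q p' q'] w (ldiv Q q' r')) \<in> \<delta>"
  proof (rule inner_cong)
    show "list_all2 (\<lambda>u v. (u, v) \<in> \<beta>) [p, ldiv Q p q] [p', ldiv Q p' q']"
      using \<beta>s congruence_ops(2) [OF \<beta> \<beta>s(1,2)] by simp
    show "word_map Q zs w \<one> = \<one>" if zs: "set zs \<subseteq> carrier Q" "length zs = length [p, ldiv Q p q]" for zs
    proof -
      obtain x c where "zs = [x, c]"
        using zs(2) by (auto simp: length_Suc_conv)
      with zs show ?thesis by (simp add: map)
    qed
    show "word_vars w \<subseteq> {..<length [p, ldiv Q p q]}" using w by simp
    show "(\<one>, ldiv Q q r) \<in> \<alpha>" by (rule ldiv_one_related) fact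
  qed fact
  then have "(ldiv Q p r, ldiv Q p' r') \<in> \<delta>"
    using congruence_ops(1) [OF \<delta> \<delta>s(1)] eq [of p q r] eq [of p' q' r'] cl by simp
  then show ?thesis
    using \<alpha>s \<beta>s congruence_trans [OF \<alpha>, of p q r] congruence_trans [OF \<alpha>, of p' q' r']
    by (simp add: same_factor_def)
qed

text \<open>For a translation \<open>f\<close>, the mapping \<open>L_(f p)^-1 f L_p\<close> fixes
  \<open>\<one>\<close> and sends \<open>ldiv Q p q\<close> to \<open>ldiv Q (f p) (f q)\<close>.
  The three choices of \<open>K\<close> and two of \<open>b\<close> cover all translations and their
  inverses.\<close>

lemma same_factor_translation:
  fixes b :: bool
  assumes pq: "same_factor p q p' q'" and c: "(c, c') \<in> \<beta>"
    and K: "K \<in> {LLetter (TVar 1), RLetter (TVar 1), MLetter (TVar 1)}"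
  defines "f \<equiv> \<lambda>x c. eval_term Q [x, c] (letter_term K b (TVar 0))"
  shows "same_factor (f p c) (f q c) (f p' c') (f q' c')"
proof -
  have \<alpha>s: "(p, q) \<in> \<alpha>" "(p', q') \<in> \<alpha>" and \<beta>s: "(p, p') \<in> \<beta>" "(q, q') \<in> \<beta>"
    and \<delta>s: "(ldiv Q p q, ldiv Q p' q') \<in> \<delta>"
    using pq by (auto simp: same_factor_def)
  have cl: "p \<in> carrier Q" "q \<in> carrier Q" "p' \<in> carrier Q" "q' \<in> carrier Q"
      "c \<in> carrier Q" "c' \<in> carrier Q"
    using \<beta>s [THEN congruence_closed [OF \<beta>]] c [THEN congruence_closed [OF \<beta>]] by auto
  have K1: "letter_vars K = {1}" using K by auto
  have f_closed: "f x d \<in> carrier Q" if "x \<in> carrier Q" "d \<in> carrier Q" for x d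
    unfolding f_def using that K1 by (intro eval_term_closed) auto
  have f_cong: "(f x d, f x' d') \<in> \<theta>"
    if "loop_congruence Q \<theta>" "(x, x') \<in> \<theta>" "(d, d') \<in> \<theta>" for \<theta> x x' d d'
    unfolding f_def using that K1 by (intro congruence_eval) auto
  \<comment> \<open>Variable 0 is \<open>p\<close>, variable 1 the translating element
    \<open>c\<close>. The element \<open>f p\<close> is not a further parameter but a term in these
    two, placed inside the letter.\<close>
  define w :: word
    where "w = [(LLetter (letter_term K b (TVar 0)), False), (K, b), (LLetter (TVar 0), True)]"
  have w: "word_vars w \<subseteq> {..<Suc (Suc 0)}" using K1 by (simp add: w_def)
  have map: "word_map Q [x, d] w y = ldiv Q (f x d) (f (x \<otimes> y) d)"
    if "x \<in> carrier Q" "d \<in> carrier Q" "y \<in> carrier Q" for x d y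
    using word_map_eval [of "[x, d]" w y] that w K by (auto simp: w_def f_def)
  have "(word_map Q [p, c] w (ldiv Q p q), word_map Q [p', c'] w (ldiv Q p' q')) \<in> \<delta>"
  proof (rule inner_cong)
    show "word_map Q zs w \<one> = \<one>" if zs: "set zs \<subseteq> carrier Q" "length zs = length [p, c]" for zs
    proof -
      obtain x d where "zs = [x, d]"
        using zs(2) by (auto simp: length_Suc_conv)
      with zs show ?thesis by (simp add: map f_closed)
    qed
    show "word_vars w \<subseteq> {..<length [p, c]}" using w by simp
    show "(\<one>, ldiv Q p q) \<in> \<alpha>" by (rule ldiv_one_related) fact
    show "list_all2 (\<lambda>u v. (u, v) \<in> \<beta>) [p, c] [p', c']" using \<beta>s c by simp
  qed fact
  then have "(ldiv Q (f p c) (f q c), ldiv Q (f p' c') (f q' c')) \<in> \<delta>"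
    using cl by (simp add: map)
  then show ?thesis
    unfolding same_factor_def
    by (intro conjI f_cong [OF \<alpha>] f_cong [OF \<beta>] congruence_refl [OF \<alpha>] \<alpha>s \<beta>s c cl)
qed

text \<open>One argument changes at a time, through the intermediate value at \<open>q\<close> and
  \<open>r\<close>. In its first and second argument respectively, the product is an R and an L
  translation, \<open>ldiv\<close> an M and an inverse L, and \<open>rdiv\<close> an inverse R and
  an inverse M.\<close>

lemma same_factor_ops:
  assumes "same_factor p q p' q'" "same_factor r s r' s'"
  shows "same_factor (p \<otimes> r) (q \<otimes> s) (p' \<otimes> r') (q' \<otimes> s')"
    and "same_factor (ldiv Q p r) (ldiv Q q s) (ldiv Q p' r') (ldiv Q q' s')"
    and "same_factor (rdiv Q p r) (rdiv Q q s) (rdiv Q p' r') (rdiv Q q' s')"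
proof -
  have \<beta>s: "(q, q') \<in> \<beta>" "(r, r') \<in> \<beta>"
    using assms by (auto simp: same_factor_def)
  note t1 = same_factor_translation [OF assms(1) \<beta>s(2)]
  note t2 = same_factor_translation [OF assms(2) \<beta>s(1)]
  show "same_factor (p \<otimes> r) (q \<otimes> s) (p' \<otimes> r') (q' \<otimes> s')"
    by (rule same_factor_trans [where q = "q \<otimes> r" and q' = "q' \<otimes> r'"])
      (use t1 [of "RLetter (TVar 1)" True] t2 [of "LLetter (TVar 1)" True] in simp_all)
  show "same_factor (ldiv Q p r) (ldiv Q q s) (ldiv Q p' r') (ldiv Q q' s')"
    by (rule same_factor_trans [where q = "ldiv Q q r" and q' = "ldiv Q q' r'"])
      (use t1 [of "MLetter (TVar 1)" True] t2 [of "LLetter (TVar 1)" False] in simp_all)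
  show "same_factor (rdiv Q p r) (rdiv Q q s) (rdiv Q p' r') (rdiv Q q' s')"
    by (rule same_factor_trans [where q = "rdiv Q q r" and q' = "rdiv Q q' r'"])
      (use t1 [of "RLetter (TVar 1)" False] t2 [of "MLetter (TVar 1)" False] in simp_all)
qed

text \<open>At variable 0 both factors are \<open>ldiv Q a b\<close>; at other variables and at
  \<open>TOne\<close> both are \<open>\<one>\<close>. The operations are handled by
  \<open>same_factor_ops\<close>.\<close>

lemma same_factor_eval:
  assumes ab: "(a, b) \<in> \<alpha>" and us: "list_all2 (\<lambda>u v. (u, v) \<in> \<beta>) us vs"
    and t: "term_vars t \<subseteq> {..<Suc (length us)}"
  shows "same_factor (eval_term Q (a # us) t) (eval_term Q (b # us) t)
    (eval_term Q (a # vs) t) (eval_term Q (b # vs) t)"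
  using t
proof (induction t)
  case (TVar i)
  show ?case
  proof (cases i)
    case 0
    have "a \<in> carrier Q" "b \<in> carrier Q" using congruence_closed [OF \<alpha> ab] by auto
    then have "same_factor a b a b"
      unfolding same_factor_def
      by (intro conjI ab congruence_refl [OF \<beta>] congruence_refl [OF \<delta>] ldiv_closed)
    with 0 show ?thesis by simp
  next
    case (Suc j)
    then have "j < length us" using TVar by simp
    with Suc show ?thesis
      using same_factor_refl [OF list_all2_nthD [OF us]] by simp
  qed
next
  case TOne
  show ?case using same_factor_refl [OF congruence_refl [OF \<beta> one_closed]] by simp
next
  case (TMult s t)
  show ?case
    unfolding eval_term.simps by (rule same_factor_ops(1)) (use TMult in auto)
next
  case (TLdiv s t)
  show ?case
    unfolding eval_term.simps by (rule same_factor_ops(2)) (use TLdiv in auto)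
next
  case (TRdiv s t)
  show ?case
    unfolding eval_term.simps by (rule same_factor_ops(3)) (use TRdiv in auto)
qed

text \<open>The value at \<open>b\<close> is the value at \<open>a\<close> times the factor between
  them; for \<open>us\<close> and \<open>vs\<close> both the values at \<open>a\<close> and the
  factors are \<delta>-related.\<close>

lemma centralizes: "centralizes Q \<alpha> \<beta> \<delta>"
  unfolding centralizes_def
proof (intro allI impI; elim conjE)
  fix t a b us vs
  assume ab: "(a, b) \<in> \<alpha>" and us: "list_all2 (\<lambda>u v. (u, v) \<in> \<beta>) us vs"
    and t: "term_vars t \<subseteq> {..<Suc (length us)}"
    and eq: "(eval_term Q (a # us) t, eval_term Q (a # vs) t) \<in> \<delta>"
  have s: "same_factor (eval_term Q (a # us) t) (eval_term Q (b # us) t)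
      (eval_term Q (a # vs) t) (eval_term Q (b # vs) t)"
    using same_factor_eval [OF ab us t] .
  then have "(eval_term Q (a # us) t, eval_term Q (b # us) t) \<in> \<alpha>"
      "(eval_term Q (a # vs) t, eval_term Q (b # vs) t) \<in> \<alpha>"
    and factor: "(ldiv Q (eval_term Q (a # us) t) (eval_term Q (b # us) t),
      ldiv Q (eval_term Q (a # vs) t) (eval_term Q (b # vs) t)) \<in> \<delta>"
    by (simp_all add: same_factor_def)
  from this(1,2) [THEN congruence_closed [OF \<alpha>]] congruence_ops(1) [OF \<delta> eq factor]
  show "(eval_term Q (b # us) t, eval_term Q (b # vs) t) \<in> \<delta>"
    by simp
qed

end

section \<open>The two inclusions\<close>

text \<open>The term condition is used for \<open>word_term w\<close>, passing from
  \<open>\<one>\<close> to \<open>a\<close> in variable 0. Its premise is the pair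
  \<open>(\<one>, \<one>)\<close>.\<close>

lemma (in loop) centralizes_word_map:
  assumes cent: "centralizes Q \<alpha> \<beta> \<delta>" and \<beta>: "loop_congruence Q \<beta>"
    and \<alpha>: "loop_congruence Q \<alpha>" and \<delta>: "loop_congruence Q \<delta>"
    and w: "word_vars w \<subseteq> {..<length us}" and us: "list_all2 (\<lambda>u v. (u, v) \<in> \<beta>) us vs"
    and one: "word_map Q us w \<one> = \<one>" "word_map Q vs w \<one> = \<one>" and a: "(\<one>, a) \<in> \<alpha>"
  shows "(word_map Q us w a, word_map Q vs w a) \<in> \<delta>"
proof -
  note c = congruence_list_closed [OF \<beta> us]
  have eq: "word_map Q us w y = eval_term Q (y # us) (word_term w)"
    "word_map Q vs w y = eval_term Q (y # vs) (word_term w)" if "y \<in> carrier Q" for y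
    using c w that by (auto intro!: word_map_eval)
  have t: "term_vars (word_term w) \<subseteq> {..<Suc (length us)}"
    using term_vars_word_term [of w] w by fastforce
  have "(eval_term Q (\<one> # us) (word_term w), eval_term Q (\<one> # vs) (word_term w)) \<in> \<delta>"
    using one congruence_refl [OF \<delta> one_closed] by (simp flip: eq)
  then have "(eval_term Q (a # us) (word_term w), eval_term Q (a # vs) (word_term w)) \<in> \<delta>"
    using cent [unfolded centralizes_def, rule_format, of \<one> a us vs "word_term w"] a us t by simp
  then show ?thesis
    using congruence_closed [OF \<alpha> a] by (simp add: eq)
qed

theorem theorem2p1:
  fixes V :: "'a loop set" and \<W> :: "word set" and Q :: "'a loop"
    and \<alpha> \<beta> :: "('a \<times> 'a) set"
  assumes universe: "infinite (UNIV :: 'a set)"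
    and variety: "loop_variety V"
    and words: "\<W> \<subseteq> loop_words"
    and generates: "generates_TInn V \<W>"
    and Q: "Q \<in> V"
    and \<alpha>: "loop_congruence Q \<alpha>"
    and \<beta>: "loop_congruence Q \<beta>"
  shows "commutator Q \<alpha> \<beta> =
    Cg Q {(word_map Q us w a, word_map Q vs w a) | w a us vs.
      w \<in> \<W> \<and> (\<one>\<^bsub>Q\<^esub>, a) \<in> \<alpha> \<and> list_all2 (\<lambda>u v. (u, v) \<in> \<beta>) us vs \<and>
      word_vars w \<subseteq> {..<length us}}"
proof -
  let ?X = "{(word_map Q us w a, word_map Q vs w a) | w a us vs.
      w \<in> \<W> \<and> (\<one>\<^bsub>Q\<^esub>, a) \<in> \<alpha> \<and> list_all2 (\<lambda>u v. (u, v) \<in> \<beta>) us vs \<and>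
      word_vars w \<subseteq> {..<length us}}"
  interpret loop Q
    using variety Q by (auto simp: loop_variety_def)
  have fixes_one: "word_map Q us w \<one>\<^bsub>Q\<^esub> = \<one>\<^bsub>Q\<^esub>"
    if "w \<in> \<W>" "set us \<subseteq> carrier Q" "word_vars w \<subseteq> {..<length us}" for w us
    using inner_word_fixes_one [OF _ Q that(2,3)] generates that(1) by (simp add: generates_TInn_def)
  have "?X \<subseteq> commutator Q \<alpha> \<beta>"
  proof clarify
    fix w a us vs
    assume w: "w \<in> \<W>" "word_vars w \<subseteq> {..<length us}" and a: "(\<one>\<^bsub>Q\<^esub>, a) \<in> \<alpha>"
      and us: "list_all2 (\<lambda>u v. (u, v) \<in> \<beta>) us vs"
    show "(word_map Q us w a, word_map Q vs w a) \<in> commutator Q \<alpha> \<beta>"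
      using congruence_list_closed [OF \<beta> us] w
      by (intro centralizes_word_map [OF commutator_centralizes \<beta> \<alpha> _ w(2) us _ _ a]
          commutator_congruence \<alpha> \<beta> fixes_one) auto
  qed
  moreover have cong: "loop_congruence Q (Cg Q ?X)"
  proof (rule Cg_congruence, clarify)
    fix w a us vs
    assume w: "word_vars w \<subseteq> {..<length us}" and a: "(\<one>\<^bsub>Q\<^esub>, a) \<in> \<alpha>"
      and us: "list_all2 (\<lambda>u v. (u, v) \<in> \<beta>) us vs"
    show "word_map Q us w a \<in> carrier Q \<and> word_map Q vs w a \<in> carrier Q"
      using congruence_list_closed [OF \<beta> us] congruence_closed [OF \<alpha> a] w
      by (simp add: word_map_closed)
  qed
  moreover have "centralizes Q \<alpha> \<beta> (Cg Q ?X)"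
  proof -
    have rel: "(word_map Q us w a, word_map Q vs w a) \<in> Cg Q ?X"
      if "w \<in> \<W>" "(\<one>\<^bsub>Q\<^esub>, a) \<in> \<alpha>" "list_all2 (\<lambda>u v. (u, v) \<in> \<beta>) us vs" "word_vars w \<subseteq> {..<length us}"
      for w a us vs
      using that by (intro subsetD [OF Cg_superset]) blast
    \<comment> \<open>\<open>rel\<close> concerns words in \<open>\<W>\<close> only;
      \<open>inner_word_related\<close> extends it to all words that fix \<open>\<one>\<close>, as
      the locale demands.\<close>
    interpret inner_related Q \<alpha> \<beta> "Cg Q ?X"
    proof unfold_locales
      fix w us vs y
      assume "word_vars w \<subseteq> {..<length us}" "list_all2 (\<lambda>u v. (u, v) \<in> \<beta>) us vs" "(\<one>\<^bsub>Q\<^esub>, y) \<in> \<alpha>"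
        and "\<And>zs. \<lbrakk>set zs \<subseteq> carrier Q; length zs = length us\<rbrakk> \<Longrightarrow> word_map Q zs w \<one>\<^bsub>Q\<^esub> = \<one>\<^bsub>Q\<^esub>"
      then show "(word_map Q us w y, word_map Q vs w y) \<in> Cg Q ?X"
        using inner_word_related [OF universe variety generates Q \<alpha> \<beta> cong rel] by blast
    qed (fact \<alpha> \<beta> cong)+
    show ?thesis by (rule centralizes)
  qed
  ultimately show ?thesis
    using Cg_least [of "commutator Q \<alpha> \<beta>" ?X] commutator_congruence [OF \<alpha> \<beta>] commutator_least
    by blast
qed

end
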